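(* Let $n\ge2$ be an integer and let $p$ be a power-law distribution over $[k]$ with power $\alpha>0$, where $k\in\mathbb Z^+\cup\{\infty\}$. Then \[ H^{\mathcal S}_n(p)\le7\log n+e^2\cdot\min\{k,\ \mathcal U^k_n(\alpha)\}, \] where \[ \mathcal U^k_n(\alpha):=\begin{cases} n^{\frac1{1+\alpha}}&\text{if }\alpha\ge1+\frac1{\log k};\\[2pt] \left(\frac n{\log n}\right)^{\frac1{1+\alpha}}&\text{if }1\le\alpha<1+\frac1{\log k};\\[2pt] \sqrt n\left(\frac k{\sqrt n}\wedge\left(\frac{\sqrt n}k\right)^{\frac{1-\alpha}{1+\alpha}}\right)&\text{if }0\le\alpha<1. \end{cases} \]
   Context: A distribution $p$ over $\mathbb Z$ is a power-law with power $\alpha>0$ if it has support $[k]:=\{1,\dots,k\}$ for some $k\in\mathbb Z^+\cup\{\infty\}$ (with $[\infty]=\{1,2,\dots\}$) and $p_x\propto x^{-\alpha}$ for all $x\in[k]$ (so $k=\infty$ is possible only if $\alpha>1$). Here $a\wedge b=\min\{a,b\}$, $\log$ is the natural logarithm, and $1/\log k$ is read as $0$ for $k=\infty$ and $+\infty$ for $k=1$. For integers $j\ge1$ let $I_j:=\left((j-1)^2\frac{\log n}{n},\ j^2\frac{\log n}{n}\right]$, let $p_{I_j}$ be the number of symbols $x$ with $p_x\in I_j$, and define $H^{\mathcal S}_n(p):=\sum_{j\ge1}\min\{p_{I_j},\ j\cdot\log n\}$. *)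

theory Defs
  imports "HOL-Probability.Probability"
begin

definition support_upto :: "enat \<Rightarrow> int set" where
  "support_upto k = {x. 1 \<le> x \<and> enat (nat x) \<le> k}"

definition power_law :: "enat \<Rightarrow> real \<Rightarrow> int pmf \<Rightarrow> bool" where
  "power_law k \<alpha> p \<longleftrightarrow> 1 \<le> k \<and> 0 < \<alpha> \<and> set_pmf p = support_upto k \<and>
     (\<exists>c. \<forall>x\<in>support_upto k. pmf p x = c * (real_of_int x) powr (- \<alpha>))"

definition I_int :: "nat \<Rightarrow> nat \<Rightarrow> real set" where
  "I_int n j = {(real j - 1)\<^sup>2 * (ln (real n) / real n) <.. (real j)\<^sup>2 * (ln (real n) / real n)}"

(* Extended-valued on purpose: the number of symbols is infinite for j = 1 when
   the support is infinite, where card would return 0. *)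
definition symbol_count :: "int pmf \<Rightarrow> real set \<Rightarrow> ennreal" where
  "symbol_count p I = emeasure (count_space UNIV) {x. pmf p x \<in> I}"

definition H_S :: "nat \<Rightarrow> int pmf \<Rightarrow> ennreal" where
  "H_S n p = (\<Sum>\<^sub>\<infinity>j\<in>{1..}. min (symbol_count p (I_int n j)) (ennreal (real j * ln (real n))))"

definition inv_log :: "enat \<Rightarrow> ereal" where
  "inv_log k = (case k of enat m \<Rightarrow> if m = 1 then \<infinity> else ereal (1 / ln (real m)) | \<infinity> \<Rightarrow> 0)"

(* In the last branch the value 0 at k = \<infinity> is the limit of the finite formula;
   a power law with \<alpha> < 1 never has infinite support. *)
definition U_bound :: "nat \<Rightarrow> enat \<Rightarrow> real \<Rightarrow> real" where
  "U_bound n k \<alpha> =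
    (if ereal \<alpha> \<ge> 1 + inv_log k then (real n) powr (1 / (1 + \<alpha>))
     else if 1 \<le> \<alpha> then (real n / ln (real n)) powr (1 / (1 + \<alpha>))
     else (case k of
         enat m \<Rightarrow> sqrt (real n) *
           min (real m / sqrt (real n)) ((sqrt (real n) / real m) powr ((1 - \<alpha>) / (1 + \<alpha>)))
       | \<infinity> \<Rightarrow> 0))"

end

theory Submission
  imports Defs
begin

text \<open>
  Write \<open>L = ln n\<close>. Bounding the summands with \<open>j \<le> J\<close> by \<open>j L\<close> and counting all
  symbols in the remaining intervals gives, with \<open>J = \<lceil>sqrt (T / L)\<rceil>\<close>,
  \<open>H \<le> 7 L + 3/5 T + #{x. p x > T / n}\<close>. For \<open>p x = c x powr (- \<alpha>)\<close> the last term is at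
  most \<open>(c n / T) powr (1 / \<alpha>)\<close>, and \<open>T\<close> is chosen to balance the two terms. The three
  regimes differ only in the bound on \<open>c\<close>: it is at most \<open>1\<close>, of order \<open>1 / ln k\<close>, or at
  most \<open>k powr (\<alpha> - 1)\<close>. In the middle regime \<open>H \<le> k\<close> settles small \<open>k\<close>; otherwise
  \<open>ln k\<close> is of order \<open>L\<close>.
\<close>

section \<open>Bounds on \<open>H_S\<close> that do not use the power-law form\<close>

lemma sum_real_upto:
  "(\<Sum>j\<in>{1..J}. real j) = real J * (real J + 1) / 2"
  by (induction J) (auto simp: field_simps)

text \<open>The intervals \<open>I_int n j\<close> are pairwise disjoint, so the symbol counts for
  \<open>j > J\<close> add up to at most the number of symbols above the left end of
  \<open>I_int n (J + 1)\<close>.\<close>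

lemma H_S_le_split:
  assumes "n \<ge> 2"
  shows "H_S n p \<le> ennreal (real J * (real J + 1) / 2 * ln (real n))
           + emeasure (count_space UNIV) {x. (real J)\<^sup>2 * (ln (real n) / real n) < pmf p x}"
proof -
  define L where "L = ln (real n)"
  define t where "t = L / real n"
  have L: "L > 0" and t: "t > 0" using assms by (auto simp: L_def t_def)
  define C where "C = emeasure (count_space (UNIV :: int set))"
  define S where "S = (\<lambda>j. {x. pmf p x \<in> I_int n j})"
  define f where "f = (\<lambda>j. min (symbol_count p (I_int n j)) (ennreal (real j * L)))"
  have disj: "disjoint_family_on S {1..}"
  proof -
    have "S i \<inter> S j = {}" if "i < j" for i j
    proof -
      have "(real i)\<^sup>2 \<le> (real j - 1)\<^sup>2"
        using that by (intro power_mono) auto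
      hence "(real i)\<^sup>2 * t \<le> (real j - 1)\<^sup>2 * t" using t by simp
      thus ?thesis unfolding S_def I_int_def t_def L_def by force
    qed
    thus ?thesis unfolding disjoint_family_on_def by (metis inf_commute linorder_neqE_nat)
  qed
  \<comment> \<open>In \<open>ennreal\<close> the infinite sum is the supremum of its finite partial
    sums, so a bound uniform in \<open>F\<close> is enough.\<close>
  have "(\<Sum>j\<in>F. f j) \<le> ennreal (real J * (real J + 1) / 2 * L) + C {x. (real J)\<^sup>2 * t < pmf p x}"
    if F: "finite F" "F \<subseteq> {1..}" for F
  proof -
    have "(\<Sum>j\<in>F. f j) = (\<Sum>j\<in>F \<inter> {1..J}. f j) + (\<Sum>j\<in>F - {1..J}. f j)"
      using F by (metis sum.Int_Diff)
    also have "(\<Sum>j\<in>F \<inter> {1..J}. f j) \<le> (\<Sum>j\<in>F \<inter> {1..J}. ennreal (real j * L))"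
      by (intro sum_mono) (auto simp: f_def)
    also have "\<dots> \<le> (\<Sum>j\<in>{1..J}. ennreal (real j * L))"
      by (intro sum_mono2) auto
    also have "\<dots> = ennreal (\<Sum>j\<in>{1..J}. real j * L)"
      using L by (intro sum_ennreal) auto
    also have "(\<Sum>j\<in>{1..J}. real j * L) = real J * (real J + 1) / 2 * L"
      by (simp only: sum_real_upto flip: sum_distrib_right)
    also have "(\<Sum>j\<in>F - {1..J}. f j) \<le> (\<Sum>j\<in>F - {1..J}. C (S j))"
      by (intro sum_mono) (auto simp: f_def symbol_count_def C_def S_def)
    also have "\<dots> = C (\<Union>j\<in>F - {1..J}. S j)"
      unfolding C_def using F disj
      by (intro sum_emeasure) (auto intro: disjoint_family_on_mono)
    also have "\<dots> \<le> C {x. (real J)\<^sup>2 * t < pmf p x}"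
      unfolding C_def
    proof (intro emeasure_mono)
      show "(\<Union>j\<in>F - {1..J}. S j) \<subseteq> {x. (real J)\<^sup>2 * t < pmf p x}"
      proof
        fix x assume "x \<in> (\<Union>j\<in>F - {1..J}. S j)"
        then obtain j where j: "j \<in> F" "j \<notin> {1..J}" "x \<in> S j" by auto
        have "j > J" using j F by auto
        hence "(real J)\<^sup>2 * t \<le> (real j - 1)\<^sup>2 * t"
          using t by (intro mult_right_mono power_mono) auto
        with j(3) show "x \<in> {x. (real J)\<^sup>2 * t < pmf p x}"
          unfolding S_def I_int_def t_def L_def by auto
      qed
    qed auto
    finally show ?thesis by (simp add: add_mono)
  qed
  moreover have "H_S n p = (SUP F\<in>{F. finite F \<and> F \<subseteq> {1..}}. sum f F)"
    unfolding H_S_def f_def L_def by (intro nonneg_infsum_complete) auto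
  ultimately show ?thesis
    unfolding L_def t_def C_def by (auto intro!: SUP_least)
qed

lemma H_S_le_threshold:
  assumes "n \<ge> 2" "T \<ge> 0"
  shows "H_S n p \<le> ennreal (7 * ln (real n) + 3/5 * T)
           + emeasure (count_space UNIV) {x. T / real n < pmf p x}"
proof -
  define L where "L = ln (real n)"
  have L: "L > 0" using assms by (auto simp: L_def)
  define s where "s = sqrt (T / L)"
  have s: "s \<ge> 0" "s\<^sup>2 * L = T" using L assms by (auto simp: s_def)
  define J where "J = nat \<lceil>s\<rceil>"
  have J: "s \<le> real J" "real J \<le> s + 1" using s(1) unfolding J_def by linarith+
  have "real J * (real J + 1) / 2 \<le> (s + 1) * (s + 1 + 1) / 2"
    using J s by (intro divide_right_mono mult_mono) auto
  also have "\<dots> \<le> 7 + 3/5 * s\<^sup>2"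
  proof -
    \<comment> \<open>A tenth of this square absorbs the linear term:
      \<open>3/2 * s <= s^2 / 10 + 45/8\<close>, and \<open>1 + 45/8 <= 7\<close>.\<close>
    have "0 \<le> (s - 15/2)\<^sup>2" by simp
    thus ?thesis by (simp add: power2_eq_square field_simps)
  qed
  finally have "real J * (real J + 1) / 2 * L \<le> (7 + 3/5 * s\<^sup>2) * L"
    using L by (intro mult_right_mono) auto
  also have "\<dots> = 7 * L + 3/5 * T" using s(2) by (simp add: algebra_simps)
  finally have 1: "real J * (real J + 1) / 2 * L \<le> 7 * L + 3/5 * T" .
  have "T = s\<^sup>2 * L" using s by simp
  also have "\<dots> \<le> (real J)\<^sup>2 * L" using J s L by (intro mult_right_mono power_mono) auto
  finally have "T / real n \<le> (real J)\<^sup>2 * (L / real n)"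
    using assms by (simp add: divide_right_mono)
  hence "emeasure (count_space UNIV) {x. (real J)\<^sup>2 * (L / real n) < pmf p x}
      \<le> emeasure (count_space UNIV) {x. T / real n < pmf p x}"
    by (intro emeasure_mono) auto
  with 1 show ?thesis
    using H_S_le_split[OF assms(1), of p J] unfolding L_def
    by (meson add_mono ennreal_leI order_trans)
qed

lemma H_S_le_support:
  assumes "n \<ge> 2" "set_pmf p = support_upto k"
  shows "H_S n p \<le> ennreal_of_enat k"
proof (cases k)
  case (enat m)
  have "{x. 0 < pmf p x} = set_pmf p" by (simp add: set_pmf.rep_eq pmf.rep_eq zero_less_measure_iff)
  also have "\<dots> = {1..int m}"
    unfolding assms(2) enat support_upto_def by auto
  finally have "emeasure (count_space UNIV) {x. 0 < pmf p x} = of_nat m" by simp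
  \<comment> \<open>With \<open>J = 0\<close> the first term vanishes and the second counts the
    whole support.\<close>
  thus ?thesis
    using H_S_le_split[OF assms(1), of p 0] unfolding enat by simp
qed auto

section \<open>The normalising constant of a power law\<close>

text \<open>The left side is the mass of the first \<open>m\<close> symbols. Stopping at a finite
  \<open>m\<close> treats finite and infinite support alike.\<close>

lemma power_law_partial_sum_le_1:
  assumes p: "\<forall>x\<in>support_upto k. pmf p x = c * real_of_int x powr (- \<alpha>)" and m: "enat m \<le> k"
  shows "c * (\<Sum>i=1..m. real i powr (- \<alpha>)) \<le> 1"
proof -
  have "c * (\<Sum>i=1..m. real i powr (- \<alpha>)) = (\<Sum>i=1..m. pmf p (int i))"
    unfolding sum_distrib_left
  proof (intro sum.cong refl)
    fix i assume i: "i \<in> {1..m}"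
    hence "enat i \<le> k" using m by (meson atLeastAtMost_iff enat_ord_simps(1) order_trans)
    hence "int i \<in> support_upto k" using i by (auto simp: support_upto_def)
    with p show "c * real i powr (- \<alpha>) = pmf p (int i)" by simp
  qed
  also have "\<dots> = (\<Sum>x\<in>int ` {1..m}. pmf p x)"
    by (subst sum.reindex) auto
  also have "\<dots> = measure p (int ` {1..m})"
    by (simp add: measure_measure_pmf_finite)
  also have "\<dots> \<le> 1" by simp
  finally show ?thesis .
qed

text \<open>Each of the first \<open>m\<close> terms is at least the last one. Taking
  \<open>m = 1\<close> gives \<open>c \<le> 1\<close>, and \<open>m = k\<close> gives the bound for
  \<alpha> below 1.\<close>

lemma power_law_coeff_le_powr:
  assumes p: "\<forall>x\<in>support_upto k. pmf p x = c * real_of_int x powr (- \<alpha>)"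
    and m: "enat m \<le> k" "m \<ge> 1" and c: "c > 0" and a: "\<alpha> > 0"
  shows "c * real m powr (1 - \<alpha>) \<le> 1"
proof -
  have "real m powr (1 - \<alpha>) = (\<Sum>i=1..m. real m powr (- \<alpha>))"
    using m by (simp add: powr_diff powr_minus field_simps)
  also have "\<dots> \<le> (\<Sum>i=1..m. real i powr (- \<alpha>))"
    using a by (intro sum_mono powr_mono2') auto
  finally have "c * real m powr (1 - \<alpha>) \<le> c * (\<Sum>i=1..m. real i powr (- \<alpha>))"
    using c by simp
  also have "\<dots> \<le> 1" by (rule power_law_partial_sum_le_1[OF p m(1)])
  finally show ?thesis .
qed

text \<open>For \<alpha> this close to 1 every term up to \<open>m\<close> is within a factor
  \<open>exp 1\<close> of \<open>1 / i\<close>, so the partial sum is comparable to a harmonic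
  sum.\<close>

lemma power_law_coeff_ln_le_exp:
  assumes p: "\<forall>x\<in>support_upto k. pmf p x = c * real_of_int x powr (- \<alpha>)"
    and m: "enat m \<le> k" "m \<ge> 1" and c: "c > 0"
    and a: "\<alpha> \<ge> 1" "(\<alpha> - 1) * ln (real m) \<le> 1"
  shows "c * ln (real m) \<le> exp 1"
proof -
  have "ln (real m) \<le> ln (real m + 1)" using m by simp
  also have "\<dots> \<le> harm m" using ln_le_harm by simp
  also have "\<dots> = (\<Sum>i=1..m. 1 / real i)" by (simp add: harm_def inverse_eq_divide)
  also have "\<dots> \<le> (\<Sum>i=1..m. exp 1 * real i powr (- \<alpha>))"
  proof (intro sum_mono)
    fix i assume i: "i \<in> {1..m}"
    have "(\<alpha> - 1) * ln (real i) \<le> (\<alpha> - 1) * ln (real m)"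
      using i a by (intro mult_left_mono) auto
    hence "real i powr (\<alpha> - 1) \<le> exp 1" using i a by (simp add: powr_def)
    hence "real i powr (\<alpha> - 1) * real i powr (- \<alpha>) \<le> exp 1 * real i powr (- \<alpha>)"
      by (intro mult_right_mono) auto
    moreover have "real i powr (\<alpha> - 1) * real i powr (- \<alpha>) = 1 / real i"
      using i powr_add[of "real i" "\<alpha> - 1" "- \<alpha>", symmetric]
      by (simp only: algebra_simps) (simp add: powr_minus_divide)
    ultimately show "1 / real i \<le> exp 1 * real i powr (- \<alpha>)" by simp
  qed
  finally have "c * ln (real m) \<le> exp 1 * (c * (\<Sum>i=1..m. real i powr (- \<alpha>)))"
    using c by (simp add: mult.left_commute flip: sum_distrib_left)
  also have "\<dots> \<le> exp 1 * 1"
    by (intro mult_left_mono power_law_partial_sum_le_1[OF p m(1)]) auto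
  finally show ?thesis by simp
qed

section \<open>Counting symbols above a threshold and balancing\<close>

text \<open>Solving \<open>b < c * x powr (- \<alpha>)\<close> for \<open>x\<close> leaves only
  positive integers up to the right side.\<close>

lemma power_law_count_above_le:
  assumes p: "\<forall>x\<in>set_pmf p. x \<ge> 1 \<and> pmf p x = c * real_of_int x powr (- \<alpha>)"
    and c: "c > 0" and a: "\<alpha> > 0" and b: "b > 0"
  shows "emeasure (count_space UNIV) {x. b < pmf p x} \<le> ennreal ((c / b) powr (1 / \<alpha>))"
proof -
  define y where "y = (c / b) powr (1 / \<alpha>)"
  have y: "y \<ge> 0" by (simp add: y_def)
  have "{x. b < pmf p x} \<subseteq> {1..\<lfloor>y\<rfloor>}"
  proof
    fix x assume "x \<in> {x. b < pmf p x}"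
    hence x: "b < pmf p x" by simp
    hence "x \<in> set_pmf p" using b by (auto simp: set_pmf_iff)
    hence x1: "x \<ge> 1" and "b < c * real_of_int x powr (- \<alpha>)" using p x by auto
    hence "real_of_int x powr \<alpha> \<le> c / b"
      using b by (simp add: powr_minus field_simps)
    hence "(real_of_int x powr \<alpha>) powr (1 / \<alpha>) \<le> y"
      unfolding y_def using a by (intro powr_mono2) auto
    hence "real_of_int x \<le> y" using x1 a by (simp add: powr_powr)
    thus "x \<in> {1..\<lfloor>y\<rfloor>}" using x1 by (simp add: le_floor_iff)
  qed
  hence "emeasure (count_space UNIV) {x. b < pmf p x} \<le> emeasure (count_space UNIV) {1..\<lfloor>y\<rfloor>}"
    by (intro emeasure_mono) auto
  also have "\<dots> = ennreal (real (nat \<lfloor>y\<rfloor>))" by (simp add: ennreal_of_nat_eq_real_of_nat)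
  also have "\<dots> \<le> ennreal y" using y by (intro ennreal_leI) linarith
  finally show ?thesis unfolding y_def .
qed

text \<open>The threshold is \<open>T = A * M\<close>, and \<open>B * M\<close> then bounds the number of symbols above \<open>T / n\<close>.\<close>

lemma H_S_power_law_le:
  assumes n: "n \<ge> 2"
    and p: "\<forall>x\<in>set_pmf p. x \<ge> 1 \<and> pmf p x = c * real_of_int x powr (- \<alpha>)"
    and c: "c > 0" and a: "\<alpha> > 0" and M: "M > 0" and A: "A > 0" and B: "B > 0"
    and bound: "c * real n \<le> A * B powr \<alpha> * M powr (1 + \<alpha>)"
    and AB: "3/5 * A + B \<le> exp 2"
  shows "H_S n p \<le> ennreal (7 * ln (real n)) + ennreal (exp 2) * ennreal M"
proof -
  \<comment> \<open>Of the power \<open>1 + \<alpha>\<close> of \<open>M\<close>, one factor goes to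
    the threshold \<open>A * M\<close> and the rest to the count \<open>B * M\<close>.\<close>
  have "c * real n \<le> (B * M) powr \<alpha> * (A * M)"
    using bound A B M by (simp add: powr_add powr_mult mult_ac)
  hence "c / (A * M / real n) \<le> (B * M) powr \<alpha>"
    using A M n by (simp add: pos_divide_le_eq)
  hence count: "(c / (A * M / real n)) powr (1 / \<alpha>) \<le> ((B * M) powr \<alpha>) powr (1 / \<alpha>)"
    using a c A M by (intro powr_mono2) auto
  have "emeasure (count_space UNIV) {x. A * M / real n < pmf p x}
      \<le> ennreal ((c / (A * M / real n)) powr (1 / \<alpha>))"
    using A M n by (intro power_law_count_above_le[OF p c a]) auto
  also have "\<dots> \<le> ennreal (((B * M) powr \<alpha>) powr (1 / \<alpha>))"
    using count by (rule ennreal_leI)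
  also have "((B * M) powr \<alpha>) powr (1 / \<alpha>) = B * M" using a B M by (simp add: powr_powr)
  finally have "emeasure (count_space UNIV) {x. A * M / real n < pmf p x} \<le> ennreal (B * M)" .
  hence "H_S n p \<le> ennreal (7 * ln (real n) + 3/5 * (A * M)) + ennreal (B * M)"
    using H_S_le_threshold[OF n, of "A * M" p] A M
    by (meson add_left_mono mult_nonneg_nonneg less_imp_le order_trans)
  also have "\<dots> = ennreal (7 * ln (real n) + (3/5 * A + B) * M)"
    using A B M n by (simp add: algebra_simps flip: ennreal_plus)
  also have "\<dots> \<le> ennreal (7 * ln (real n) + exp 2 * M)"
    using AB M by (intro ennreal_leI add_left_mono mult_right_mono) auto
  also have "\<dots> = ennreal (7 * ln (real n)) + ennreal (exp 2) * ennreal M"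
    using M n by (simp add: ennreal_mult)
  finally show ?thesis .
qed

section \<open>Numerical estimates and the constant in the middle regime\<close>

text \<open>The middle regime needs \<open>3/5 * 5 + 3 = 6\<close>. The quadratic Taylor bound at 2
  gives only 5, hence the detour through \<open>exp (1/2)\<close>.\<close>

lemma exp_2_ge_6: "exp 2 \<ge> (6 :: real)"
proof -
  have "(13/8 :: real) \<le> exp (1/2)"
    using exp_lower_Taylor_quadratic[of "1/2::real"] by (simp add: power2_eq_square)
  hence "(13/8 :: real) ^ 4 \<le> exp (1/2) ^ 4" by (intro power_mono) auto
  also have "\<dots> = exp 2" by (simp flip: exp_of_nat_mult)
  finally show ?thesis by (simp add: power4_eq_xxxx)
qed

lemma ln_le_half:
  assumes "x > 0"
  shows "ln x \<le> x / (2 :: real)"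
proof -
  have "ln (x / 2) \<le> x / 2 - 1" using assms by (intro ln_le_minus_one) auto
  thus ?thesis using assms ln_2_less_1 by (simp add: ln_div)
qed

text \<open>A large \<open>m\<close> turns the bound on \<open>c * ln m\<close> into one on
  \<open>c * ln n\<close>: here \<open>ln m\<close> is at least \<open>ln n / 5\<close>, and
  \<open>15 = 5 * 3\<close> with \<open>exp 1 \<le> 3\<close>.\<close>

lemma power_law_coeff_middle_bound:
  assumes p: "\<forall>x\<in>support_upto k. pmf p x = c * real_of_int x powr (- \<alpha>)"
    and n: "n \<ge> 2" and m: "enat m \<le> k" and c: "c > 0"
    and a: "\<alpha> \<ge> 1" "(\<alpha> - 1) * ln (real m) \<le> 1"
    and big: "exp 2 * (real n / ln (real n)) powr (1 / (1 + \<alpha>)) \<le> real m"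
  shows "c * ln (real n) \<le> 15"
proof -
  define L where "L = ln (real n)"
  have L: "L > 0" using n by (auto simp: L_def)
  \<comment> \<open>Dividing \<open>n\<close> by \<open>L\<close> costs at most half of its
    logarithm.\<close>
  have Ln: "L / 2 \<le> ln (real n / L)"
    using ln_le_half[OF L] n L by (simp add: ln_div L_def)
  have "m > 0"
  proof (rule ccontr)
    assume "\<not> m > 0"
    moreover have "exp 2 * (real n / ln (real n)) powr (1 / (1 + \<alpha>)) > 0"
      using n by simp
    ultimately show False using big by simp
  qed
  have "ln (exp 2 * (real n / L) powr (1 / (1 + \<alpha>))) \<le> ln (real m)"
    using big n \<open>m > 0\<close> unfolding L_def by (subst ln_le_cancel_iff) auto
  hence lnm: "2 + ln (real n / L) / (1 + \<alpha>) \<le> ln (real m)"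
    using n L by (simp add: ln_mult ln_powr)
  have "0 \<le> ln (real n / L) / (1 + \<alpha>)" using Ln L a by auto
  hence lnm2: "ln (real m) \<ge> 2" using lnm by simp
  \<comment> \<open>The factor \<open>exp 2\<close> in \<open>big\<close> yields
    \<open>ln m \<ge> 2\<close>, which forces \<open>\<alpha> - 1 \<le> 1/2\<close>.\<close>
  have "(\<alpha> - 1) * 2 \<le> (\<alpha> - 1) * ln (real m)" using lnm2 a by (intro mult_left_mono) auto
  hence "1 + \<alpha> \<le> 5/2" using a by simp
  hence "L / 2 / (5/2) \<le> ln (real n / L) / (1 + \<alpha>)"
    using Ln L a by (intro frac_le) auto
  hence "L / 2 / (5/2) \<le> ln (real m)" using lnm by linarith
  hence "L / 5 \<le> ln (real m)" by simp
  hence "c * (L / 5) \<le> c * ln (real m)" using c by simp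
  also have "\<dots> \<le> exp 1"
    using power_law_coeff_ln_le_exp[OF p m _ c a] \<open>m > 0\<close> by simp
  also have "\<dots> \<le> 3" by (rule exp_le)
  finally show ?thesis by (simp add: L_def)
qed

section \<open>Assembling the three regimes\<close>

lemma power_law_coeff_obtain:
  assumes "power_law k \<alpha> p"
  obtains c where "c > 0" "\<forall>x\<in>support_upto k. pmf p x = c * real_of_int x powr (- \<alpha>)"
proof -
  from assms obtain c where k: "1 \<le> k" and s: "set_pmf p = support_upto k"
    and c: "\<forall>x\<in>support_upto k. pmf p x = c * real_of_int x powr (- \<alpha>)"
    unfolding power_law_def by auto
  have 1: "1 \<in> support_upto k" using k by (simp add: support_upto_def one_enat_def)
  hence "pmf p 1 > 0" using s pmf_positive by metis
  hence "c > 0" using c 1 by force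
  thus thesis using that c by auto
qed

text \<open>Otherwise \<open>c * m powr (1 - \<alpha>)\<close> would stay below 1 for every
  \<open>m\<close>, although it is unbounded. This keeps the value of \<open>U_bound\<close> at
  infinite \<open>k\<close> in its last branch out of reach.\<close>

lemma power_law_infinite_support:
  assumes "power_law \<infinity> \<alpha> p"
  shows "\<alpha> \<ge> 1"
proof (rule ccontr)
  assume "\<not> \<alpha> \<ge> 1"
  hence a: "0 < \<alpha>" "\<alpha> < 1" using assms by (auto simp: power_law_def)
  obtain c where c: "c > 0"
    and p: "\<forall>x\<in>support_upto \<infinity>. pmf p x = c * real_of_int x powr (- \<alpha>)"
    using power_law_coeff_obtain[OF assms] by blast
  define z where "z = (1 / c) powr (1 / (1 - \<alpha>))"
  obtain m :: nat where m: "real m > z" using reals_Archimedean2 by blast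
  have "z powr (1 - \<alpha>) < real m powr (1 - \<alpha>)"
    using m a by (intro powr_less_mono2) (auto simp: z_def)
  hence "1 < c * real m powr (1 - \<alpha>)"
    using a c by (simp add: z_def powr_powr field_simps)
  moreover have "m \<ge> 1" using m by (cases m) (auto simp: z_def not_less)
  ultimately show False using power_law_coeff_le_powr[OF p _ _ c a(1), of m] by simp
qed

theorem theorem18:
  fixes n :: nat and k :: enat and \<alpha> :: real and p :: "int pmf"
  assumes "n \<ge> 2"
    and "power_law k \<alpha> p"
  shows "H_S n p \<le> ennreal (7 * ln (real n))
           + ennreal (exp 2) * min (ennreal_of_enat k) (ennreal (U_bound n k \<alpha>))"
proof -
  have n: "n \<ge> 2" by fact
  have k: "1 \<le> k" and a: "\<alpha> > 0" and supp: "set_pmf p = support_upto k"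
    using assms(2) by (auto simp: power_law_def)
  obtain c where c: "c > 0"
    and p: "\<forall>x\<in>support_upto k. pmf p x = c * real_of_int x powr (- \<alpha>)"
    using power_law_coeff_obtain[OF assms(2)] by blast
  have p': "\<forall>x\<in>set_pmf p. x \<ge> 1 \<and> pmf p x = c * real_of_int x powr (- \<alpha>)"
    using p supp by (auto simp: support_upto_def)
  have c1: "c \<le> 1"
    using power_law_coeff_le_powr[OF p _ _ c a, of 1] k by (simp add: one_enat_def)
  have Hk: "H_S n p \<le> ennreal_of_enat k" by (rule H_S_le_support[OF n supp])
  have scale: "x \<le> ennreal (7 * ln (real n)) + ennreal (exp 2) * x" for x
  proof -
    have "1 * x \<le> ennreal (exp 2) * x"
      using exp_2_ge_6 by (intro mult_right_mono) (auto simp flip: ennreal_1 intro!: ennreal_leI)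
    thus ?thesis by (simp add: add_increasing)
  qed
  have Hk': "H_S n p \<le> ennreal (7 * ln (real n)) + ennreal (exp 2) * ennreal_of_enat k"
    using Hk scale by (rule order_trans)
  have "H_S n p \<le> ennreal (7 * ln (real n)) + ennreal (exp 2) * ennreal (U_bound n k \<alpha>)"
  proof -
    consider "ereal \<alpha> \<ge> 1 + inv_log k" | "\<not> ereal \<alpha> \<ge> 1 + inv_log k" "1 \<le> \<alpha>"
      | "\<not> ereal \<alpha> \<ge> 1 + inv_log k" "\<alpha> < 1" by linarith
    thus ?thesis
    proof cases
      case 1
      have "real n powr (1 / (1 + \<alpha>)) > 0" using n by simp
      moreover have "c * real n \<le> 1 * 1 powr \<alpha> * (real n powr (1 / (1 + \<alpha>))) powr (1 + \<alpha>)"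
        using c1 n a by (simp add: powr_powr)
      moreover have "3/5 * 1 + 1 \<le> exp (2::real)" using exp_2_ge_6 by linarith
      ultimately show ?thesis
        using H_S_power_law_le[OF n p' c a, of "real n powr (1 / (1 + \<alpha>))" 1 1] 1
        by (simp add: U_bound_def)
    next
      case 2
      \<comment> \<open>For infinite \<open>k\<close> the value \<open>inv_log k\<close> is 0, and
        the two conditions of this case contradict each other.\<close>
      obtain m where m: "k = enat m"
        using 2 by (cases k) (auto simp: inv_log_def one_ereal_def)
      have m1: "m \<ge> 1" using k m by (simp add: one_enat_def)
      define M where "M = (real n / ln (real n)) powr (1 / (1 + \<alpha>))"
      have U: "U_bound n k \<alpha> = M" using 2 by (simp add: U_bound_def M_def)
      have M: "M > 0" using n by (simp add: M_def)
      \<comment> \<open>For \<open>m = 1\<close> the value \<open>inv_log k\<close> is infinite and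
        gives no bound on \<alpha>, but \<open>ln 1 = 0\<close>.\<close>
      have am: "(\<alpha> - 1) * ln (real m) \<le> 1"
      proof (cases "m = 1")
        case False
        hence "ln (real m) > 0" using m1 by simp
        moreover have "\<alpha> < 1 + 1 / ln (real m)"
          using 2 m False by (simp add: inv_log_def one_ereal_def not_le)
        ultimately show ?thesis by (simp add: field_simps)
      qed auto
      show ?thesis
      proof (cases "exp 2 * M \<le> real m")
        case True
        have "c * ln (real n) \<le> 15"
          using power_law_coeff_middle_bound[OF p n _ c 2(2) am] m True by (simp add: M_def)
        hence "c * real n \<le> 15 * (real n / ln (real n))"
          using n by (simp add: field_simps)
        \<comment> \<open>Since \<open>\<alpha> \<ge> 1\<close>, the constant 15 splits as
          \<open>A = 5\<close> and \<open>B = 3\<close>, for which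
          \<open>3/5 * A + B = 6\<close>.\<close>
        also have "\<dots> \<le> 5 * 3 powr \<alpha> * (real n / ln (real n))"
          using powr_mono[of 1 \<alpha> "3::real"] 2 n by (intro mult_right_mono) auto
        also have "real n / ln (real n) = M powr (1 + \<alpha>)"
          using n a by (simp add: M_def powr_powr)
        finally show ?thesis
          using H_S_power_law_le[OF n p' c a M, of 5 3] exp_2_ge_6 U by simp
      next
        case False
        have "H_S n p \<le> ennreal (real m)"
          using Hk m by (simp add: ennreal_of_nat_eq_real_of_nat)
        also have "\<dots> \<le> ennreal (exp 2 * M)" using False by (intro ennreal_leI) auto
        also have "\<dots> = ennreal (exp 2) * ennreal M" using M by (simp add: ennreal_mult)
        finally show ?thesis unfolding U by (simp add: add_increasing)
      qed
    next
      case 3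
      obtain m where m: "k = enat m"
        using 3 power_law_infinite_support[of \<alpha> p] assms(2) by (cases k) auto
      have m1: "m \<ge> 1" using k m by (simp add: one_enat_def)
      define M where "M = sqrt (real n) * (sqrt (real n) / real m) powr ((1 - \<alpha>) / (1 + \<alpha>))"
      \<comment> \<open>Multiplying the minimum out by \<open>sqrt n\<close> turns its first entry
        into \<open>m\<close>, where the support bound \<open>Hk'\<close> applies.\<close>
      have U: "U_bound n k \<alpha> = min (real m) M"
        using 3 m n by (simp add: U_bound_def M_def min_mult_distrib_left)
      have M: "M > 0" using n m1 by (simp add: M_def)
      have "M powr (1 + \<alpha>) = sqrt (real n) powr (1 + \<alpha>) * (sqrt (real n) / real m) powr (1 - \<alpha>)"
        using a by (simp add: M_def powr_mult powr_powr)
      also have "\<dots> = sqrt (real n) powr ((1 + \<alpha>) + (1 - \<alpha>)) / real m powr (1 - \<alpha>)"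
        unfolding powr_add using n m1 by (simp add: powr_divide)
      also have "sqrt (real n) powr ((1 + \<alpha>) + (1 - \<alpha>)) = real n"
        using n by simp
      finally have Mp: "M powr (1 + \<alpha>) = real n / real m powr (1 - \<alpha>)" .
      have "c * real m powr (1 - \<alpha>) \<le> 1"
        using power_law_coeff_le_powr[OF p _ m1 c a] m by simp
      hence "(c * real m powr (1 - \<alpha>)) * real n \<le> 1 * real n" by (intro mult_right_mono) auto
      hence "c * real n \<le> M powr (1 + \<alpha>)"
        unfolding Mp using m1 by (simp add: field_simps)
      hence HM: "H_S n p \<le> ennreal (7 * ln (real n)) + ennreal (exp 2) * ennreal M"
        using H_S_power_law_le[OF n p' c a M, of 1 1] exp_2_ge_6 by simp
      have Hm: "H_S n p \<le> ennreal (7 * ln (real n)) + ennreal (exp 2) * ennreal (real m)"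
        using Hk' m by (simp add: ennreal_of_nat_eq_real_of_nat)
      show ?thesis unfolding U using HM Hm by (simp add: min_def)
    qed
  qed
  with Hk' show ?thesis by (simp add: min_def)
qed

end
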